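(* For every rack $R$, the lattice $\mathcal{R}(R)$ of subracks of $R$ is atomic.
   Context: A rack is a set $R$ with a binary operation $\triangleright$ such that (i) $a\triangleright(b\triangleright c)=(a\triangleright b)\triangleright(a\triangleright c)$ for all $a,b,c\in R$, and (ii) for all $a,b\in R$ there is a unique $c\in R$ with $a\triangleright c=b$. A subset $Q\subseteq R$ is a subrack if $(Q,\triangleright)$ is a rack; the empty set counts as a subrack. $\mathcal{R}(R)$ is the set of all subracks of $R$ ordered by inclusion; it is a lattice with least element $\emptyset$, in which arbitrary joins exist (the join of a family of subracks is the intersection of all subracks containing their union). In a lattice $L$ with least element $0$, an atom is an element $a\neq 0$ such that $x<a$ implies $x=0$. $L$ is atomic if every element of $L$ is the join of the atoms below (i.e. less than or equal to) it. *)

theory Defs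
  imports "HOL-Algebra.Complete_Lattice"
begin

text \<open>
  The carrier may be empty, since the empty set counts as a subrack.
\<close>

locale rack =
  fixes R :: "'a set" and rop :: "'a \<Rightarrow> 'a \<Rightarrow> 'a"  (infixr \<open>\<triangleright>\<close> 70)
  assumes closed: "\<lbrakk>a \<in> R; b \<in> R\<rbrakk> \<Longrightarrow> a \<triangleright> b \<in> R"
    and self_distrib:
      "\<lbrakk>a \<in> R; b \<in> R; c \<in> R\<rbrakk> \<Longrightarrow> a \<triangleright> (b \<triangleright> c) = (a \<triangleright> b) \<triangleright> (a \<triangleright> c)"
    and left_div: "\<lbrakk>a \<in> R; b \<in> R\<rbrakk> \<Longrightarrow> \<exists>!c. c \<in> R \<and> a \<triangleright> c = b"

text \<open>
  By \<open>left_div\<close>, a subrack is closed under left division and not only under \<open>\<triangleright>\<close>;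
  for an infinite rack this is an additional requirement.
\<close>

definition subrack :: "'a set \<Rightarrow> 'a set \<Rightarrow> ('a \<Rightarrow> 'a \<Rightarrow> 'a) \<Rightarrow> bool"
  where "subrack Q R rop \<longleftrightarrow> Q \<subseteq> R \<and> rack Q rop"

definition subrack_lattice :: "'a set \<Rightarrow> ('a \<Rightarrow> 'a \<Rightarrow> 'a) \<Rightarrow> 'a set gorder"
  where "subrack_lattice R rop = \<lparr>carrier = {Q. subrack Q R rop}, eq = (=), le = (\<subseteq>)\<rparr>"

definition atom :: "('a, 'b) gorder_scheme \<Rightarrow> 'a \<Rightarrow> bool"
  where "atom L a \<longleftrightarrow>
    a \<in> carrier L \<and> a \<noteq> \<bottom>\<^bsub>L\<^esub> \<and>
    (\<forall>x \<in> carrier L. x \<sqsubset>\<^bsub>L\<^esub> a \<longrightarrow> x = \<bottom>\<^bsub>L\<^esub>)"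

text \<open>
  The join is expressed by \<^const>\<open>least\<close> rather than by an equation with the choice-based
  operator \<open>\<Squnion>\<close>, so that the existence of the join is part of the assertion.
\<close>

definition atomic :: "('a, 'b) gorder_scheme \<Rightarrow> bool"
  where "atomic L \<longleftrightarrow>
    (\<forall>x \<in> carrier L. least L x (Upper L {a. atom L a \<and> a \<sqsubseteq>\<^bsub>L\<^esub> x}))"

lemma carrier_subrack_lattice [simp]:
  "carrier (subrack_lattice R rop) = {Q. subrack Q R rop}"
  by (simp add: subrack_lattice_def)

lemma eq_subrack_lattice [simp]: "eq (subrack_lattice R rop) = (=)"
  by (simp add: subrack_lattice_def)

lemma le_subrack_lattice [simp]: "le (subrack_lattice R rop) = (\<subseteq>)"
  by (simp add: subrack_lattice_def)

lemma lless_subrack_lattice [simp]: "lless (subrack_lattice R rop) = (\<subset>)"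
  by (auto simp: lless_def fun_eq_iff)

lemma partial_order_subrack_lattice: "partial_order (subrack_lattice R rop)"
  by standard auto

lemma subrack_empty: "subrack {} R rop"
  by (simp add: subrack_def rack_def)

lemma bottom_subrack_lattice [simp]: "\<bottom>\<^bsub>subrack_lattice R rop\<^esub> = {}"
  unfolding bottom_def
  by (rule some_equality) (use subrack_empty in \<open>fastforce simp: least_def\<close>)+

lemma subrack_Inter:
  assumes "rack R rop" and sub: "\<And>Q. Q \<in> B \<Longrightarrow> subrack Q R rop" and "B \<noteq> {}"
  shows "subrack (\<Inter>B) R rop"
proof -
  interpret R: rack R rop by fact
  from \<open>B \<noteq> {}\<close> sub have le: "\<Inter>B \<subseteq> R"
    by (auto simp: subrack_def)
  have "rack (\<Inter>B) rop"
  proof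
    fix a b assume "a \<in> \<Inter>B" "b \<in> \<Inter>B"
    with sub show "rop a b \<in> \<Inter>B"
      by (auto simp: subrack_def rack_def)
  next
    fix a b c assume "a \<in> \<Inter>B" "b \<in> \<Inter>B" "c \<in> \<Inter>B"
    with le show "rop a (rop b c) = rop (rop a b) (rop a c)"
      by (intro R.self_distrib) auto
  next
    fix a b assume ab: "a \<in> \<Inter>B" "b \<in> \<Inter>B"
    with le have "a \<in> R" "b \<in> R" by auto
    then obtain c where c: "c \<in> R" "rop a c = b"
      and uniq: "\<And>d. d \<in> R \<Longrightarrow> rop a d = b \<Longrightarrow> d = c"
      using R.left_div by blast
    have "c \<in> Q" if "Q \<in> B" for Q
    proof -
      from that sub have "rack Q rop" "Q \<subseteq> R" by (auto simp: subrack_def)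
      moreover have "a \<in> Q" "b \<in> Q" using ab that by auto
      ultimately obtain d where "d \<in> Q" "rop a d = b"
        using rack.left_div by metis
      with uniq \<open>Q \<subseteq> R\<close> show ?thesis by blast
    qed
    with c uniq le show "\<exists>!d. d \<in> \<Inter>B \<and> rop a d = b" by blast
  qed
  with le show ?thesis by (simp add: subrack_def)
qed

theorem complete_lattice_subrack_lattice:
  assumes "rack R rop"
  shows "complete_lattice (subrack_lattice R rop)"
proof (rule partial_order.complete_lattice_criterion1 [OF partial_order_subrack_lattice])
  show "\<exists>g. greatest (subrack_lattice R rop) g (carrier (subrack_lattice R rop))"
    using assms by (intro exI [of _ R]) (auto simp: greatest_def subrack_def)
next
  fix B assume "B \<subseteq> carrier (subrack_lattice R rop)" "B \<noteq> {}"
  with subrack_Inter [OF assms, of B]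
  have "greatest (subrack_lattice R rop) (\<Inter>B) (Lower (subrack_lattice R rop) B)"
    by (auto simp: greatest_def Lower_def)
  then show "\<exists>i. greatest (subrack_lattice R rop) i (Lower (subrack_lattice R rop) B)" ..
qed

lemma join_subrack_lattice:
  assumes "rack R rop" and "\<And>Q. Q \<in> B \<Longrightarrow> subrack Q R rop"
  shows "least (subrack_lattice R rop) (\<Inter>{Q. subrack Q R rop \<and> \<Union>B \<subseteq> Q})
           (Upper (subrack_lattice R rop) B)"
proof -
  have "\<Union>B \<subseteq> R" using assms(2) by (auto simp: subrack_def)
  then have "{Q. subrack Q R rop \<and> \<Union>B \<subseteq> Q} \<noteq> {}"
    using assms(1) by (auto simp: subrack_def)
  then have "subrack (\<Inter>{Q. subrack Q R rop \<and> \<Union>B \<subseteq> Q}) R rop"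
    by (intro subrack_Inter [OF assms(1)]) auto
  moreover have "\<Inter>{Q. subrack Q R rop \<and> \<Union>B \<subseteq> Q} \<subseteq> U"
    if "U \<in> Upper (subrack_lattice R rop) B" for U
  proof -
    from that assms(2) have "subrack U R rop" "\<Union>B \<subseteq> U"
      by (auto simp: Upper_def)
    then show ?thesis by blast
  qed
  ultimately show ?thesis
    by (auto simp: least_def Upper_def)
qed

end

theory Submission
  imports Defs
begin

text \<open>
  The point is that every element \<open>x\<close> of a rack lies in an atom, namely in the subrack
  \<open>A\<close> that it generates; a subrack \<open>Q\<close> is then the union, and a fortiori the join, of the atoms
  below it.

  To see that \<open>A\<close> is an atom, consider the left translations \<open>\<lambda>c. y \<triangleright> c\<close>.  The elements with
  the same left translation as \<open>x\<close> form a subrack, so all elements of \<open>A\<close> act in the same way,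
  by the permutation \<open>\<phi> = (\<lambda>c. x \<triangleright> c)\<close>.  Below \<open>A\<close>, being a subrack therefore just means being
  invariant under \<open>\<phi>\<close> and its inverse (in effect \<open>A\<close> is the \<open>\<phi>\<close>-orbit of \<open>x\<close>).
  This condition is stable under complements: if \<open>S \<subseteq> A\<close> is a subrack, then so is \<open>A - S\<close>.
  One of the two contains \<open>x\<close> and hence is all of \<open>A\<close>.
\<close>

context rack
begin

lemma left_cancel:
  "\<lbrakk>a \<in> R; b \<in> R; c \<in> R; a \<triangleright> b = a \<triangleright> c\<rbrakk> \<Longrightarrow> b = c"
  using left_div [of a "a \<triangleright> b"] closed [of a b] by metis

definition same_translation :: "'a \<Rightarrow> 'a set"
  where "same_translation x = {y \<in> R. \<forall>c \<in> R. y \<triangleright> c = x \<triangleright> c}"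

text \<open>
  Inside \<^term>\<open>same_translation x\<close> the operation \<open>\<triangleright>\<close> ignores its left argument, so closure
  under \<open>\<triangleright>\<close> and under left division become invariance under one permutation.
\<close>

lemma subrack_iff_translation_invariant:
  assumes x: "x \<in> R" and P: "P \<subseteq> same_translation x"
  shows "subrack P R (\<triangleright>) \<longleftrightarrow> (\<forall>y \<in> R. x \<triangleright> y \<in> P \<longleftrightarrow> y \<in> P)"
proof
  from P have PR: "P \<subseteq> R" by (auto simp: same_translation_def)
  have act: "p \<triangleright> c = x \<triangleright> c" if "p \<in> P" "c \<in> R" for p c
    using that P by (auto simp: same_translation_def)
  {
    assume "subrack P R (\<triangleright>)"
    then interpret P: rack P "(\<triangleright>)" by (simp add: subrack_def)
    show "\<forall>y \<in> R. x \<triangleright> y \<in> P \<longleftrightarrow> y \<in> P"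
    proof (intro ballI iffI)
      fix y assume y: "y \<in> R" and xy: "x \<triangleright> y \<in> P"
      \<comment> \<open>Any element of \<open>P\<close> translates like \<open>x\<close>; the one at hand is \<open>x \<triangleright> y\<close> itself.\<close>
      from P.left_div [OF xy xy] obtain c
        where c: "c \<in> P" "(x \<triangleright> y) \<triangleright> c = x \<triangleright> y" by blast
      with act [OF xy] PR have "x \<triangleright> c = x \<triangleright> y" by auto
      with c(1) PR x y have "c = y" by (auto intro: left_cancel)
      with c(1) show "y \<in> P" by simp
    next
      fix y assume "y \<in> R" "y \<in> P"
      with P.closed [of y y] act [of y y] show "x \<triangleright> y \<in> P" by simp
    qed
  next
    assume inv: "\<forall>y \<in> R. x \<triangleright> y \<in> P \<longleftrightarrow> y \<in> P"
    have "rack P (\<triangleright>)"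
    proof
      fix a b assume "a \<in> P" "b \<in> P"
      with inv act PR show "a \<triangleright> b \<in> P" by auto
    next
      fix a b c assume "a \<in> P" "b \<in> P" "c \<in> P"
      with PR show "a \<triangleright> (b \<triangleright> c) = (a \<triangleright> b) \<triangleright> (a \<triangleright> c)"
        by (intro self_distrib) auto
    next
      fix a b assume ab: "a \<in> P" "b \<in> P"
      with PR have "a \<in> R" "b \<in> R" by auto
      with left_div obtain c where c: "c \<in> R" "a \<triangleright> c = b" by blast
      with ab act inv have "c \<in> P" by auto
      with c \<open>a \<in> R\<close> PR show "\<exists>!c. c \<in> P \<and> a \<triangleright> c = b"
        by (auto intro: left_cancel)
    qed
    with PR show "subrack P R (\<triangleright>)" by (simp add: subrack_def)
  }
qed

text \<open>
  Self-distributivity says that the translation by \<open>x \<triangleright> y\<close> is the conjugate of the translation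
  by \<open>y\<close> under the translation \<open>\<phi>\<close> by \<open>x\<close>, and a permutation equals \<open>\<phi>\<close> if and only if its
  conjugate by \<open>\<phi>\<close> does.
\<close>

lemma subrack_same_translation:
  assumes x: "x \<in> R"
  shows "subrack (same_translation x) R (\<triangleright>)"
proof -
  have "x \<triangleright> y \<in> same_translation x \<longleftrightarrow> y \<in> same_translation x" if y: "y \<in> R" for y
  proof
    assume "x \<triangleright> y \<in> same_translation x"
    then have xy: "(x \<triangleright> y) \<triangleright> c = x \<triangleright> c" if "c \<in> R" for c
      using that by (simp add: same_translation_def)
    have "y \<triangleright> c = x \<triangleright> c" if c: "c \<in> R" for c
    proof (rule left_cancel [of x])
      show "x \<triangleright> (y \<triangleright> c) = x \<triangleright> (x \<triangleright> c)"
        using self_distrib [OF x y c] xy [OF closed [OF x c]] by simp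
    qed (use x y c closed in auto)
    with y show "y \<in> same_translation x" by (simp add: same_translation_def)
  next
    assume "y \<in> same_translation x"
    then have yx: "y \<triangleright> c = x \<triangleright> c" if "c \<in> R" for c
      using that by (simp add: same_translation_def)
    have "(x \<triangleright> y) \<triangleright> c = x \<triangleright> c" if "c \<in> R" for c
    proof -
      from left_div [OF x that] obtain d where d: "d \<in> R" "x \<triangleright> d = c" by blast
      with self_distrib [OF x y d(1)] yx [OF d(1)] show ?thesis by simp
    qed
    with x y closed show "x \<triangleright> y \<in> same_translation x" by (simp add: same_translation_def)
  qed
  then show ?thesis
    using subrack_iff_translation_invariant [OF x order_refl] by blast
qed

definition generated_subrack :: "'a \<Rightarrow> 'a set"
  where "generated_subrack x = \<Inter>{Q. subrack Q R (\<triangleright>) \<and> x \<in> Q}"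

lemma generated_subrack_least:
  "\<lbrakk>subrack Q R (\<triangleright>); x \<in> Q\<rbrakk> \<Longrightarrow> generated_subrack x \<subseteq> Q"
  by (auto simp: generated_subrack_def)

lemma generated_subrack_contains: "x \<in> generated_subrack x"
  by (simp add: generated_subrack_def)

lemma subrack_generated_subrack:
  assumes "x \<in> R"
  shows "subrack (generated_subrack x) R (\<triangleright>)"
proof -
  have "subrack R R (\<triangleright>)" by (simp add: subrack_def rack_axioms)
  with assms show ?thesis
    unfolding generated_subrack_def by (intro subrack_Inter rack_axioms) auto
qed

lemma atom_generated_subrack:
  assumes x: "x \<in> R"
  shows "atom (subrack_lattice R (\<triangleright>)) (generated_subrack x)"
proof -
  let ?A = "generated_subrack x"
  have "x \<in> same_translation x" using x by (simp add: same_translation_def)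
  then have A: "?A \<subseteq> same_translation x"
    using generated_subrack_least subrack_same_translation [OF x] by blast
  have minimal: "S = {}" if S: "subrack S R (\<triangleright>)" "S \<subset> ?A" for S
  proof -
    have "x \<notin> S" using S generated_subrack_least by blast
    have "\<forall>y \<in> R. x \<triangleright> y \<in> S \<longleftrightarrow> y \<in> S"
      using subrack_iff_translation_invariant [OF x, of S] S A by blast
    moreover have "\<forall>y \<in> R. x \<triangleright> y \<in> ?A \<longleftrightarrow> y \<in> ?A"
      using subrack_iff_translation_invariant [OF x A] subrack_generated_subrack [OF x] by blast
    ultimately have "subrack (?A - S) R (\<triangleright>)"
      using subrack_iff_translation_invariant [OF x, of "?A - S"] A by blast
    with \<open>x \<notin> S\<close> have "?A \<subseteq> ?A - S"
      by (intro generated_subrack_least) (simp_all add: generated_subrack_contains)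
    with S(2) show "S = {}" by blast
  qed
  have "?A \<noteq> {}" using generated_subrack_contains by blast
  with minimal show ?thesis
    by (simp add: atom_def subrack_generated_subrack [OF x])
qed

end

theorem corollary2p6:
  fixes R :: "'a set" and rop :: "'a \<Rightarrow> 'a \<Rightarrow> 'a"
  assumes "rack R rop"
  shows "atomic (subrack_lattice R rop)"
proof -
  interpret rack R rop by fact
  let ?L = "subrack_lattice R rop"
  have "least ?L Q (Upper ?L {a. atom ?L a \<and> a \<subseteq> Q})" if Q: "subrack Q R rop" for Q
  proof -
    have "Q \<subseteq> U" if U: "U \<in> Upper ?L {a. atom ?L a \<and> a \<subseteq> Q}" for U
    proof
      fix x assume x: "x \<in> Q"
      with Q have "x \<in> R" by (auto simp: subrack_def)
      then have a: "atom ?L (generated_subrack x)" by (rule atom_generated_subrack)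
      moreover have "generated_subrack x \<subseteq> Q" using Q x by (rule generated_subrack_least)
      ultimately have "generated_subrack x \<subseteq> U"
        using U by (auto simp: Upper_def atom_def)
      then show "x \<in> U" using generated_subrack_contains by blast
    qed
    with Q show ?thesis by (auto simp: least_def Upper_def)
  qed
  then show ?thesis by (simp add: atomic_def)
qed

end
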